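(* Let $T\subset\mathbb{R}^2$ be a triangle, and let $\varrho_{T^{ct}_{\mathrm{bary}}}$ be the aspect ratio of the Clough--Tocher split $T^{ct}$ of $T$ when the split point is the barycenter of $T$. Then $$\frac{3}{1+\frac{a_T}{h_T}}\,\varrho_T\ \le\ \varrho_{T^{ct}_{\mathrm{bary}}}\ \le\ 3\,\varrho_T .$$
   Context: $T$ is a nondegenerate triangle with vertices $z_1,z_2,z_3$ and edges $e_i$ opposite $z_i$, $h_i=|e_i|$, labeled so that $h_1\le h_2\le h_3$; $h_T=h_3$ is the length of its longest edge and $a_T$ is the altitude of $T$ with respect to the longest edge $e_3$. $\rho_T$ is the diameter of the incircle of $T$. The aspect ratio of any triangle $T$ is $\varrho_T=h_T/\rho_T=|\partial T|h_T/(4|T|)$. The barycenter is $\frac13(z_1+z_2+z_3)$. The Clough--Tocher split $T^{ct}=\{K_1,K_2,K_3\}$ with respect to an interior split point $z_0$ consists of the three triangles obtained by connecting the vertices of $T$ to $z_0$. The aspect ratio of $T^{ct}$ is $\varrho_{T^{ct}}=\max_{K_i\in T^{ct}}\varrho_{K_i}$. *)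

theory Defs
  imports "HOL-Analysis.Analysis"
begin

text \<open>
  A triangle is given by an ordered triple of vertices, but the numerical quantities of a triangle
  do not depend on the order. They are meaningful for nondegenerate triangles only.
\<close>

type_synonym triangle = "(real^2) \<times> (real^2) \<times> (real^2)"

fun nondegenerate :: "triangle \<Rightarrow> bool" where
  "nondegenerate (a, b, c) \<longleftrightarrow> \<not> collinear {a, b, c}"

fun triangle_hull :: "triangle \<Rightarrow> (real^2) set" where
  "triangle_hull (a, b, c) = convex hull {a, b, c}"

fun edges :: "triangle \<Rightarrow> (real^2) set set" where
  "edges (a, b, c) = {closed_segment b c, closed_segment a c, closed_segment a b}"

fun longest_edge :: "triangle \<Rightarrow> real" where
  "longest_edge (a, b, c) = Max {dist b c, dist a c, dist a b}"

text \<open>Tangency: the circle bounds a disc lying in the triangle and meets each edge in one point.\<close>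

definition is_incircle :: "real^2 \<Rightarrow> real \<Rightarrow> triangle \<Rightarrow> bool" where
  "is_incircle p r T \<longleftrightarrow>
     r > 0 \<and> cball p r \<subseteq> triangle_hull T \<and> (\<forall>e \<in> edges T. \<exists>!x. x \<in> sphere p r \<inter> e)"

definition incircle_diameter :: "triangle \<Rightarrow> real" where
  "incircle_diameter T = 2 * (THE r. \<exists>p. is_incircle p r T)"

definition aspect_ratio :: "triangle \<Rightarrow> real" where
  "aspect_ratio T = longest_edge T / incircle_diameter T"

definition altitude :: "real^2 \<Rightarrow> real^2 \<Rightarrow> real^2 \<Rightarrow> real" where
  "altitude v a b = infdist v (affine hull {a, b})"

fun barycenter :: "triangle \<Rightarrow> real^2" where
  "barycenter (a, b, c) = (1/3) *\<^sub>R (a + b + c)"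

fun clough_tocher :: "real^2 \<Rightarrow> triangle \<Rightarrow> triangle set" where
  "clough_tocher z (a, b, c) = {(z, b, c), (a, z, c), (a, b, z)}"

definition split_aspect_ratio :: "triangle set \<Rightarrow> real" where
  "split_aspect_ratio S = Max (aspect_ratio ` S)"

end

theory Submission
  imports Defs
begin

text \<open>
  The inradius of a nondegenerate triangle is twice its area divided by its perimeter, so that
  the aspect ratio is longest edge times perimeter over four times the area
  (\<open>aspect_ratio_eq\<close>). The three subtriangles at the barycenter each have a third of the
  area of \<open>T\<close>, which is where the factor 3 comes from, and only lengths remain to be compared.

  Upper bound: a subtriangle has neither a longer longest edge nor a longer perimeter than \<open>T\<close>,
  because the distance from the barycenter to a vertex is at most a third of the sum of the two
  adjacent edges.

  Lower bound: consider the subtriangle on the longest edge \<open>e\<^sub>3\<close>. Its longest edge is at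
  least \<open>h\<^sub>T\<close>, and by the triangle inequality its perimeter is at least \<open>2 h\<^sub>T\<close>. It therefore suffices
  that \<open>h\<^sub>1 + h\<^sub>2 + h\<^sub>T \<le> (1 + a\<^sub>T / h\<^sub>T) 2 h\<^sub>T\<close>, that is, \<open>h\<^sub>1 + h\<^sub>2 \<le> h\<^sub>T + 2 a\<^sub>T\<close>. As \<open>e\<^sub>3\<close> is the longest
  edge, the foot of the altitude lies on it, and the inequality is the sum of the
  triangle inequalities in the two right triangles into which the altitude cuts \<open>T\<close>
  (\<open>legs_le_base_plus_altitude\<close>).
\<close>

section \<open>Signed area\<close>

definition rot :: "real^2 \<Rightarrow> real^2" where
  "rot u = vector [- (u$2), u$1]"

text \<open>
  Twice the signed area, positive for counterclockwise vertices. Written as an inner product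
  with the normal of the edge \<open>ab\<close>, it is also the length of that edge times the signed distance of \<open>c\<close>
  from the line through it, which is how tangency is expressed below.
\<close>

definition area2 :: "real^2 \<Rightarrow> real^2 \<Rightarrow> real^2 \<Rightarrow> real" where
  "area2 a b c = rot (b - a) \<bullet> (c - a)"

lemma area2_coords:
  "area2 a b c = (b$1 - a$1) * (c$2 - a$2) - (b$2 - a$2) * (c$1 - a$1)"
  by (simp add: area2_def rot_def inner_vec_def sum_2 algebra_simps)

lemma norm_rot [simp]: "norm (rot u) = norm u"
  by (simp add: norm_eq_sqrt_inner rot_def inner_vec_def sum_2)

lemma area2_rotate: "area2 b c a = area2 a b c"
  by (simp add: area2_coords algebra_simps)

lemma area2_swap: "area2 b a c = - area2 a b c"
  by (simp add: area2_coords algebra_simps)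

lemma area2_shift: "area2 a b x = area2 a b p + rot (b - a) \<bullet> (x - p)"
  by (simp add: area2_def inner_diff_right)

lemma area2_sum: "area2 a b p + area2 b c p + area2 c a p = area2 a b c"
  by (simp add: area2_coords algebra_simps)

lemma area2_barycentric:
  assumes "u + v + w = 1"
  shows "area2 a b (u *\<^sub>R a + v *\<^sub>R b + w *\<^sub>R c) = w * area2 a b c"
proof -
  have u: "u = 1 - v - w" using assms by simp
  show ?thesis unfolding u by (simp add: area2_coords algebra_simps)
qed

text \<open>Equality in the Cauchy--Schwarz inequality makes the two edge vectors parallel.\<close>

lemma area2_nonzero_if_noncollinear:
  assumes "\<not> collinear {a, b, c}"
  shows "area2 a b c \<noteq> 0"
proof
  assume 0: "area2 a b c = 0"
  have "((b - a) \<bullet> (c - a))\<^sup>2 + (area2 a b c)\<^sup>2 = (norm (b - a))\<^sup>2 * (norm (c - a))\<^sup>2"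
    unfolding power2_norm_eq_inner area2_coords inner_vec_def
    by (simp add: sum_2 power2_eq_square algebra_simps)
  with 0 have "((b - a) \<bullet> (c - a))\<^sup>2 = (norm (b - a) * norm (c - a))\<^sup>2"
    by (simp add: power_mult_distrib)
  then have "\<bar>(b - a) \<bullet> (c - a)\<bar> = norm (b - a) * norm (c - a)"
    by (auto simp: power2_eq_iff abs_mult)
  then have "collinear {0, b - a, c - a}"
    by (simp add: norm_cauchy_schwarz_equal)
  then have "collinear {b, a, c}" by (simp add: collinear_3)
  with assms show False by (simp add: insert_commute)
qed

text \<open>This is Cramer's rule for the barycentric coordinates of \<open>x\<close>.\<close>

lemma barycentric_coordinates:
  assumes "area2 a b c \<noteq> 0"
  shows "x = (area2 b c x / area2 a b c) *\<^sub>R a + (area2 c a x / area2 a b c) *\<^sub>R b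
           + (area2 a b x / area2 a b c) *\<^sub>R c"
proof -
  have "area2 a b c * x $ i
      = area2 b c x * a $ i + area2 c a x * b $ i + area2 a b x * c $ i" for i
    using exhaust_2[of i] by (auto simp: area2_coords algebra_simps)
  then show ?thesis
    using assms by (simp add: vec_eq_iff divide_simps) (simp add: mult.commute)
qed

lemma mem_triangle_iff_area2:
  assumes "0 < area2 a b c"
  shows "x \<in> convex hull {a, b, c}
    \<longleftrightarrow> 0 \<le> area2 a b x \<and> 0 \<le> area2 b c x \<and> 0 \<le> area2 c a x"
proof
  assume "x \<in> convex hull {a, b, c}"
  then obtain u v w where uvw: "0 \<le> u" "0 \<le> v" "0 \<le> w" "u + v + w = 1"
    and x: "x = u *\<^sub>R a + v *\<^sub>R b + w *\<^sub>R c"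
    unfolding convex_hull_3 by blast
  have "area2 a b x = w * area2 a b c"
    using area2_barycentric[OF uvw(4)] x by simp
  moreover have "area2 b c x = u * area2 b c a"
    using area2_barycentric[of v w u b c a] uvw(4) x by (simp add: add_ac)
  moreover have "area2 c a x = v * area2 c a b"
    using area2_barycentric[of w u v c a b] uvw(4) x by (simp add: add_ac)
  ultimately show "0 \<le> area2 a b x \<and> 0 \<le> area2 b c x \<and> 0 \<le> area2 c a x"
    using uvw assms area2_rotate[of a b c] area2_rotate[of b c a] by simp
next
  assume nonneg: "0 \<le> area2 a b x \<and> 0 \<le> area2 b c x \<and> 0 \<le> area2 c a x"
  have "area2 b c x / area2 a b c + area2 c a x / area2 a b c + area2 a b x / area2 a b c = 1"
    using area2_sum[of a b x c] assms by (simp flip: add_divide_distrib add: add_ac)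
  then show "x \<in> convex hull {a, b, c}"
    unfolding convex_hull_3 mem_Collect_eq
    using nonneg assms barycentric_coordinates[of a b c x]
    by (intro exI[of _ "area2 b c x / area2 a b c"] exI[of _ "area2 c a x / area2 a b c"]
          exI[of _ "area2 a b x / area2 a b c"]) simp
qed

lemma area2_eq_0_on_edge:
  assumes "x \<in> closed_segment a b"
  shows "area2 a b x = 0"
proof -
  obtain u where x: "x = (1 - u) *\<^sub>R a + u *\<^sub>R b"
    using assms by (auto simp: closed_segment_def)
  show ?thesis unfolding x by (simp add: area2_coords algebra_simps)
qed

lemma mem_edge_if_area2_eq_0:
  assumes "0 < area2 a b c" and "x \<in> convex hull {a, b, c}" and "area2 a b x = 0"
  shows "x \<in> closed_segment a b"
proof -
  have nonneg: "0 \<le> area2 b c x" "0 \<le> area2 c a x"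
    using assms mem_triangle_iff_area2 by auto
  let ?u = "area2 c a x / area2 a b c"
  have sum: "area2 a b c = area2 b c x + area2 c a x"
    using area2_sum[of a b x c] assms(3) by simp
  then have u: "1 - ?u = area2 b c x / area2 a b c" "?u \<le> 1"
    using assms(1) nonneg by (simp_all add: field_simps)
  have "x = (1 - ?u) *\<^sub>R a + ?u *\<^sub>R b"
    using barycentric_coordinates[of a b c x] assms by (simp add: u(1))
  with u(2) have "\<exists>u\<ge>0. u \<le> 1 \<and> x = (1 - u) *\<^sub>R a + u *\<^sub>R b"
    using nonneg assms(1) by (intro exI[of _ ?u]) simp
  then show ?thesis
    by (auto simp: closed_segment_def)
qed

section \<open>The incircle\<close>

text \<open>
  The point of the disc that is furthest out in the direction of the outer normal of the edge
  still lies in the triangle, so the center has distance at least \<open>r\<close> from the edge; the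
  tangent point gives the opposite inequality.
\<close>

lemma incenter_distance_from_edge:
  assumes pos: "0 < area2 a b c" and r: "0 < r" and sub: "cball p r \<subseteq> convex hull {a, b, c}"
    and x: "x \<in> sphere p r" "x \<in> closed_segment a b"
  shows "area2 a b p = r * dist a b"
proof (rule antisym)
  have "area2 a b x = area2 a b p + rot (b - a) \<bullet> (x - p)" by (rule area2_shift)
  moreover have "\<bar>rot (b - a) \<bullet> (x - p)\<bar> \<le> norm (b - a) * norm (x - p)"
    using Cauchy_Schwarz_ineq2[of "rot (b - a)" "x - p"] by simp
  ultimately show "area2 a b p \<le> r * dist a b"
    using x area2_eq_0_on_edge[OF x(2)]
    by (simp add: dist_norm norm_minus_commute mult.commute)
next
  have ne: "norm (b - a) \<noteq> 0" using pos by (auto simp: area2_coords)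
  define y where "y = p - (r / norm (b - a)) *\<^sub>R rot (b - a)"
  have "y \<in> cball p r" using ne r by (simp add: y_def dist_norm)
  then have "0 \<le> area2 a b y" using sub mem_triangle_iff_area2[OF pos] by blast
  moreover have "area2 a b y = area2 a b p - (r / norm (b - a)) * (norm (rot (b - a)))\<^sup>2"
    by (subst area2_shift[of _ _ _ p]) (simp add: y_def power2_norm_eq_inner del: norm_rot)
  ultimately show "r * dist a b \<le> area2 a b p"
    using ne by (simp add: power2_eq_square dist_norm norm_minus_commute)
qed

lemma ex1_tangent_point:
  assumes pos: "0 < area2 a b c" and r: "0 < r" and sub: "cball p r \<subseteq> convex hull {a, b, c}"
    and p: "area2 a b p = r * dist a b"
  shows "\<exists>!x. x \<in> sphere p r \<inter> closed_segment a b"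
proof -
  have ne: "norm (b - a) \<noteq> 0" using pos by (auto simp: area2_coords)
  define n where "n = (1 / norm (b - a)) *\<^sub>R rot (b - a)"
  have n: "norm n = 1" using ne by (simp add: n_def)
  have area2_n: "area2 a b x = norm (b - a) * (r + n \<bullet> (x - p))" for x
    using p ne by (subst area2_shift[of _ _ _ p])
      (simp add: n_def dist_norm norm_minus_commute algebra_simps)
  show ?thesis
  proof (rule ex1I[of _ "p - r *\<^sub>R n"])
    have s: "p - r *\<^sub>R n \<in> sphere p r" using n r by (simp add: dist_norm)
    have "area2 a b (p - r *\<^sub>R n) = 0"
      using n by (simp add: area2_n flip: power2_norm_eq_inner)
    then show "p - r *\<^sub>R n \<in> sphere p r \<inter> closed_segment a b"
      using mem_edge_if_area2_eq_0[OF pos] s sub sphere_cball by blast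
  next
    fix y assume y: "y \<in> sphere p r \<inter> closed_segment a b"
    then have "norm (y - p) = r" by (simp add: dist_norm norm_minus_commute)
    moreover have "n \<bullet> (y - p) = - r"
      using area2_n[of y] area2_eq_0_on_edge[of y a b] y ne by simp
    \<comment> \<open>The inner product with the unit vector \<open>n\<close> is extremal, so \<open>y - p\<close> is a multiple of \<open>n\<close>.\<close>
    moreover have "(norm (y - p + r *\<^sub>R n))\<^sup>2
        = (norm (y - p))\<^sup>2 + 2 * r * (n \<bullet> (y - p)) + r\<^sup>2 * (norm n)\<^sup>2"
      unfolding power2_norm_eq_inner
      by (simp add: inner_left_distrib inner_right_distrib inner_commute power2_eq_square)
    ultimately have "(norm (y - p + r *\<^sub>R n))\<^sup>2 = 0"
      using n by (simp add: power2_eq_square)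
    then have "y - p + r *\<^sub>R n = 0" by (simp only: power_eq_0_iff norm_eq_zero)
    then show "y = p - r *\<^sub>R n" by (simp add: algebra_simps eq_neg_iff_add_eq_0)
  qed
qed

text \<open>
  The area is the sum of the areas of the triangles that connect the incenter to the edges, and
  each of these has height \<open>r\<close>.
\<close>

lemma incircle_radius_eq:
  assumes pos: "0 < area2 a b c" and inc: "is_incircle p r (a, b, c)"
  shows "r * (dist a b + dist b c + dist c a) = area2 a b c"
proof -
  have r: "0 < r" and sub: "cball p r \<subseteq> convex hull {a, b, c}"
    and "\<exists>x. x \<in> sphere p r \<inter> closed_segment a b"
    and "\<exists>x. x \<in> sphere p r \<inter> closed_segment b c"
    and "\<exists>x. x \<in> sphere p r \<inter> closed_segment c a"
    using inc by (auto simp: is_incircle_def closed_segment_commute[of c a])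
  then obtain x y z where "x \<in> sphere p r" "x \<in> closed_segment a b"
    "y \<in> sphere p r" "y \<in> closed_segment b c" "z \<in> sphere p r" "z \<in> closed_segment c a"
    by blast
  then have "area2 a b p = r * dist a b" "area2 b c p = r * dist b c" "area2 c a p = r * dist c a"
    using incenter_distance_from_edge[of a b c r p x] incenter_distance_from_edge[of b c a r p y]
      incenter_distance_from_edge[of c a b r p z] pos r sub
      area2_rotate[of a b c] area2_rotate[of b c a]
    by (simp_all add: insert_commute)
  then show ?thesis
    using area2_sum[of a b p c] by (simp add: algebra_simps)
qed

text \<open>The center has barycentric coordinates proportional to the lengths of the opposite edges.\<close>

lemma ex_incircle:
  assumes pos: "0 < area2 a b c"
  shows "\<exists>p r. is_incircle p r (a, b, c)"
proof -
  define P where "P = dist a b + dist b c + dist c a"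
  have "a \<noteq> b" using pos by (auto simp: area2_coords)
  then have P: "0 < P"
    using zero_le_dist[of b c] zero_le_dist[of c a] zero_less_dist_iff[of a b]
    unfolding P_def by linarith
  define r where "r = area2 a b c / P"
  have r: "0 < r" using P pos by (simp add: r_def)
  define p where
    "p = (dist b c / P) *\<^sub>R a + (dist c a / P) *\<^sub>R b + (dist a b / P) *\<^sub>R c"
  have sum: "dist b c / P + dist c a / P + dist a b / P = 1"
    using P by (simp flip: add_divide_distrib add: P_def)
  have rotate: "area2 b c a = area2 a b c" "area2 c a b = area2 a b c"
    using area2_rotate[of a b c] area2_rotate[of b c a] by simp_all
  have ab: "area2 a b p = r * dist a b"
    using area2_barycentric[OF sum, of a b c] by (simp add: p_def r_def)
  have bc: "area2 b c p = r * dist b c"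
    using area2_barycentric[of "dist c a / P" "dist a b / P" "dist b c / P" b c a] sum rotate
    by (simp add: p_def r_def add_ac)
  have ca: "area2 c a p = r * dist c a"
    using area2_barycentric[of "dist a b / P" "dist b c / P" "dist c a / P" c a b] sum rotate
    by (simp add: p_def r_def add_ac)
  have sub: "cball p r \<subseteq> convex hull {a, b, c}"
  proof
    fix x assume x: "x \<in> cball p r"
    have "0 \<le> area2 u v x" if "area2 u v p = r * dist u v" for u v
    proof -
      have "\<bar>rot (v - u) \<bullet> (x - p)\<bar> \<le> norm (v - u) * norm (x - p)"
        using Cauchy_Schwarz_ineq2[of "rot (v - u)" "x - p"] by simp
      also have "\<dots> \<le> norm (v - u) * r"
        using x by (intro mult_left_mono) (auto simp: dist_norm norm_minus_commute)
      finally show ?thesis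
        using that area2_shift[of u v x p]
        by (simp add: dist_norm norm_minus_commute mult.commute)
    qed
    then show "x \<in> convex hull {a, b, c}"
      using mem_triangle_iff_area2[OF pos] ab bc ca by blast
  qed
  have "\<exists>!x. x \<in> sphere p r \<inter> closed_segment a b"
    using ex1_tangent_point[OF pos r sub ab] .
  moreover have "\<exists>!x. x \<in> sphere p r \<inter> closed_segment b c"
    using ex1_tangent_point[of b c a r p] pos rotate r sub bc by (simp add: insert_commute)
  moreover have "\<exists>!x. x \<in> sphere p r \<inter> closed_segment a c"
    using ex1_tangent_point[of c a b r p] pos rotate r sub ca
    by (simp add: insert_commute closed_segment_commute)
  ultimately have "is_incircle p r (a, b, c)"
    using r sub by (simp add: is_incircle_def)
  then show ?thesis by blast
qed

section \<open>Aspect ratios\<close>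

lemma is_incircle_swap: "is_incircle p r (b, a, c) \<longleftrightarrow> is_incircle p r (a, b, c)"
  unfolding is_incircle_def triangle_hull.simps edges.simps
  by (simp add: insert_commute closed_segment_commute)

lemma is_incircle_rotate: "is_incircle p r (b, c, a) \<longleftrightarrow> is_incircle p r (a, b, c)"
  unfolding is_incircle_def triangle_hull.simps edges.simps
  by (simp add: insert_commute closed_segment_commute)

lemma aspect_ratio_swap: "aspect_ratio (b, a, c) = aspect_ratio (a, b, c)"
  by (simp add: aspect_ratio_def incircle_diameter_def is_incircle_swap insert_commute dist_commute)

lemma aspect_ratio_rotate: "aspect_ratio (b, c, a) = aspect_ratio (a, b, c)"
  by (simp add: aspect_ratio_def incircle_diameter_def is_incircle_rotate insert_commute
      dist_commute)

lemma incircle_diameter_counterclockwise: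
  assumes pos: "0 < area2 a b c"
  shows "incircle_diameter (a, b, c) = 2 * area2 a b c / (dist a b + dist b c + dist c a)"
proof -
  have "a \<noteq> b" using pos by (auto simp: area2_coords)
  then have P: "0 < dist a b + dist b c + dist c a"
    using zero_le_dist[of b c] zero_le_dist[of c a] zero_less_dist_iff[of a b] by linarith
  obtain p r where inc: "is_incircle p r (a, b, c)" using ex_incircle[OF pos] by blast
  have eq: "r' = area2 a b c / (dist a b + dist b c + dist c a)"
    if "is_incircle p' r' (a, b, c)" for p' r'
    using incircle_radius_eq[OF pos that] P by (simp add: field_simps)
  have "(THE r. \<exists>p. is_incircle p r (a, b, c)) = r"
    using inc eq by (intro the_equality) blast+
  then show ?thesis by (simp add: incircle_diameter_def eq[OF inc])
qed

lemma aspect_ratio_eq: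
  assumes "area2 a b c \<noteq> 0"
  shows "aspect_ratio (a, b, c)
    = longest_edge (a, b, c) * (dist a b + dist b c + dist c a) / (2 * \<bar>area2 a b c\<bar>)"
proof (cases "0 < area2 a b c")
  case True
  then show ?thesis
    by (simp add: aspect_ratio_def incircle_diameter_counterclockwise del: longest_edge.simps)
next
  case False
  then have pos: "0 < area2 b a c" using assms by (simp add: area2_swap[of b a c])
  have "aspect_ratio (a, b, c) = aspect_ratio (b, a, c)" by (rule aspect_ratio_swap)
  also have "\<dots> = longest_edge (b, a, c) * (dist b a + dist a c + dist c b) / (2 * area2 b a c)"
    by (simp add: aspect_ratio_def incircle_diameter_counterclockwise[OF pos]
        del: longest_edge.simps)
  also have "longest_edge (b, a, c) = longest_edge (a, b, c)"
    by (simp add: insert_commute dist_commute)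
  finally show ?thesis
    using False by (simp add: area2_swap[of b a c] dist_commute add_ac del: longest_edge.simps)
qed

section \<open>The barycentric split\<close>

lemma barycenter_swap: "barycenter (b, a, c) = barycenter (a, b, c)"
  by (simp add: add_ac)

lemma area2_barycenter: "area2 a b (barycenter (a, b, c)) = area2 a b c / 3"
  using area2_barycentric[of "1/3" "1/3" "1/3" a b c] by (simp add: scaleR_add_right)

text \<open>
  This distance is two thirds of the median, and a median is at most the mean of the two
  adjacent edges.
\<close>

lemma dist_barycenter_vertex_le:
  "dist a (barycenter (a, b, c)) \<le> (dist a b + dist a c) / 3"
proof -
  have median: "barycenter (a, b, c) - a = (1/3) *\<^sub>R ((b - a) + (c - a))"
    by (simp add: vec_eq_iff)
  have "dist a (barycenter (a, b, c)) = norm (barycenter (a, b, c) - a)"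
    by (subst dist_commute) (rule dist_norm)
  also have "\<dots> = norm ((b - a) + (c - a)) / 3"
    unfolding median norm_scaleR by simp
  also have "\<dots> \<le> (norm (b - a) + norm (c - a)) / 3"
    by (intro divide_right_mono norm_triangle_ineq) simp
  finally show ?thesis by (simp add: dist_norm norm_minus_commute)
qed

lemma aspect_ratio_subtriangle_le:
  assumes nz: "area2 a b c \<noteq> 0"
  shows "aspect_ratio (a, b, barycenter (a, b, c)) \<le> 3 * aspect_ratio (a, b, c)"
proof -
  define z where "z = barycenter (a, b, c)"
  have az: "dist a z \<le> (dist a b + dist a c) / 3"
    unfolding z_def by (rule dist_barycenter_vertex_le)
  have bz: "dist b z \<le> (dist a b + dist b c) / 3"
    using dist_barycenter_vertex_le[of b a c] unfolding z_def barycenter_swap[of b a c]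
    by (simp add: dist_commute del: barycenter.simps)
  have area: "area2 a b z = area2 a b c / 3"
    unfolding z_def by (rule area2_barycenter)
  have tri: "dist a b \<le> dist a c + dist b c"
    by (rule dist_triangle2)
  have longest: "longest_edge (a, b, z) \<le> longest_edge (a, b, c)"
    using az bz by (simp add: dist_commute[of z]) (smt (verit) zero_le_dist)
  have perimeter: "dist a b + dist b z + dist z a \<le> dist a b + dist b c + dist c a"
    using az bz tri zero_le_dist[of a c] zero_le_dist[of b c]
    by (simp add: dist_commute)
  have "aspect_ratio (a, b, z)
      = 3 * (longest_edge (a, b, z) * (dist a b + dist b z + dist z a) / (2 * \<bar>area2 a b c\<bar>))"
    using aspect_ratio_eq[of a b z] nz area by (simp del: longest_edge.simps)
  also have "\<dots> \<le> 3 * (longest_edge (a, b, c) * (dist a b + dist b c + dist c a)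
                        / (2 * \<bar>area2 a b c\<bar>))"
    using longest perimeter
    by (intro mult_left_mono divide_right_mono mult_mono) (auto simp: le_max_iff_disj)
  finally show ?thesis
    using aspect_ratio_eq[OF nz] by (simp add: z_def del: longest_edge.simps barycenter.simps)
qed

text \<open>
  For a point \<open>y\<close> of the edge \<open>ab\<close>, add the triangle inequalities for \<open>a, y, c\<close> and \<open>b, y, c\<close>.
  If \<open>y\<close> lies on the line beyond \<open>a\<close>, then it is at least as far from \<open>c\<close> as \<open>a\<close> is, because the
  angle at \<open>a\<close>, not being opposite the longest edge, is not obtuse; as the other leg is at most
  \<open>ab\<close>, this suffices. Treating every point of the line in this way bounds its distance from
  \<open>c\<close> without a formula for the foot of the altitude.
\<close>

lemma legs_le_base_plus_altitude:
  assumes bc: "dist b c \<le> dist a b" and ac: "dist a c \<le> dist a b"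
  shows "dist b c + dist a c \<le> dist a b + 2 * altitude c a b"
proof -
  have "dist b c + dist a c - dist a b \<le> 2 * dist c y" if "y \<in> affine hull {a, b}" for y
  proof -
    obtain t where t: "y = a + t *\<^sub>R (b - a)"
      using \<open>y \<in> affine hull {a, b}\<close> unfolding affine_hull_2_alt by blast
    have beyond: "dist v c \<le> dist c y"
      if "dist w c \<le> dist v w" "0 \<le> s" "y = v - s *\<^sub>R (w - v)" for v w s
    proof -
      have "(norm (c - w))\<^sup>2 \<le> (norm (w - v))\<^sup>2"
        using that(1) by (simp add: dist_norm norm_minus_commute power_mono)
      moreover have "(norm (c - w))\<^sup>2
          = (norm (c - v))\<^sup>2 + (norm (w - v))\<^sup>2 - 2 * ((c - v) \<bullet> (w - v))"
        by (simp add: power2_norm_eq_inner inner_diff inner_commute)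
      ultimately have acute: "0 \<le> (c - v) \<bullet> (w - v)"
        using zero_le_power2[of "norm (c - v)"] by linarith
      have c_y: "c - y = (c - v) + s *\<^sub>R (w - v)" using that(3) by simp
      have "(norm (c - y))\<^sup>2
          = (norm (c - v))\<^sup>2 + 2 * (s * ((c - v) \<bullet> (w - v))) + s\<^sup>2 * (norm (w - v))\<^sup>2"
        unfolding power2_norm_eq_inner c_y
        by (simp add: inner_left_distrib inner_right_distrib inner_commute power2_eq_square)
      then have "(norm (c - v))\<^sup>2 \<le> (norm (c - y))\<^sup>2"
        using acute that(2) by simp
      then have "norm (c - v) \<le> norm (c - y)" by (rule power2_le_imp_le) simp
      then show ?thesis by (simp add: dist_norm norm_minus_commute)
    qed
    consider "t < 0" | "0 \<le> t" "t \<le> 1" | "1 < t" by linarith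
    then show ?thesis
    proof cases
      case 1
      then have "dist a c \<le> dist c y"
        using beyond[of b a "- t"] bc t by simp
      then show ?thesis using bc zero_le_dist[of c y] by linarith
    next
      case 2
      have "dist a y = t * dist a b" using t 2 by (simp add: dist_norm norm_minus_commute)
      moreover have "b - y = (1 - t) *\<^sub>R (b - a)" using t by (simp add: algebra_simps)
      then have "dist b y = (1 - t) * dist a b"
        using 2 by (simp add: dist_norm norm_minus_commute)
      ultimately have "dist a y + dist b y = dist a b" by (simp add: algebra_simps)
      then show ?thesis
        using dist_triangle[of a c y] dist_triangle[of b c y] by (simp add: dist_commute)
    next
      case 3
      have "y = b - (t - 1) *\<^sub>R (a - b)" using t by (simp add: algebra_simps)
      then have "dist b c \<le> dist c y"
        using beyond[of a b "t - 1"] ac 3 by (simp add: dist_commute)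
      then show ?thesis using ac zero_le_dist[of c y] by linarith
    qed
  qed
  then have "(dist b c + dist a c - dist a b) / 2 \<le> dist c y" if "y \<in> affine hull {a, b}" for y
    using that by fastforce
  then have "(dist b c + dist a c - dist a b) / 2 \<le> altitude c a b"
    unfolding altitude_def by (subst infdist_notempty) (simp, rule cINF_greatest, simp)
  then show ?thesis by simp
qed

lemma aspect_ratio_subtriangle_ge:
  assumes nz: "area2 a b c \<noteq> 0"
    and longest: "dist b c \<le> dist a b" "dist a c \<le> dist a b"
  shows "3 / (1 + altitude c a b / dist a b) * aspect_ratio (a, b, c)
    \<le> aspect_ratio (a, b, barycenter (a, b, c))"
proof -
  define z where "z = barycenter (a, b, c)"
  define q where "q = 1 + altitude c a b / dist a b"
  have "a \<noteq> b" using nz by (auto simp: area2_coords)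
  then have h: "0 < dist a b" by simp
  then have q: "0 < q"
    by (simp add: q_def altitude_def infdist_nonneg add_pos_nonneg)
  have area: "area2 a b z = area2 a b c / 3"
    unfolding z_def by (rule area2_barycenter)
  have "dist a b + dist b c + dist c a \<le> q * (2 * dist a b)"
    using legs_le_base_plus_altitude[OF longest] h
    by (simp add: q_def dist_commute algebra_simps)
  also have "\<dots> \<le> q * (dist a b + dist b z + dist z a)"
    using q dist_triangle[of a b z] by (intro mult_left_mono) (auto simp: dist_commute)
  finally have perimeter:
    "(dist a b + dist b c + dist c a) / q \<le> dist a b + dist b z + dist z a"
    using q by (simp add: divide_le_eq mult.commute)
  have "3 / q * aspect_ratio (a, b, c)
      = 3 * (dist a b * ((dist a b + dist b c + dist c a) / q) / (2 * \<bar>area2 a b c\<bar>))"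
    using aspect_ratio_eq[OF nz] longest by (simp add: max_def)
  also have "\<dots> \<le> 3 * (longest_edge (a, b, z) * (dist a b + dist b z + dist z a)
                        / (2 * \<bar>area2 a b c\<bar>))"
    using perimeter q
    by (intro mult_left_mono divide_right_mono mult_mono) (auto simp: le_max_iff_disj)
  also have "\<dots> = aspect_ratio (a, b, z)"
    using aspect_ratio_eq[of a b z] nz area by (simp del: longest_edge.simps)
  finally show ?thesis by (simp only: z_def q_def)
qed

theorem lemma2p7:
  fixes z\<^sub>1 z\<^sub>2 z\<^sub>3 :: "real^2" and T :: triangle and a\<^sub>T h\<^sub>T :: real
  assumes T: "T = (z\<^sub>1, z\<^sub>2, z\<^sub>3)" and nondeg: "nondegenerate T"
    and labels: "dist z\<^sub>2 z\<^sub>3 \<le> dist z\<^sub>1 z\<^sub>3" "dist z\<^sub>1 z\<^sub>3 \<le> dist z\<^sub>1 z\<^sub>2"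
    and h: "h\<^sub>T = longest_edge T"
    and a: "a\<^sub>T = altitude z\<^sub>3 z\<^sub>1 z\<^sub>2"
  shows "3 / (1 + a\<^sub>T / h\<^sub>T) * aspect_ratio T
           \<le> split_aspect_ratio (clough_tocher (barycenter T) T)
       \<and> split_aspect_ratio (clough_tocher (barycenter T) T) \<le> 3 * aspect_ratio T"
proof -
  define z where "z = barycenter T"
  have nz: "area2 z\<^sub>1 z\<^sub>2 z\<^sub>3 \<noteq> 0" "area2 z\<^sub>2 z\<^sub>3 z\<^sub>1 \<noteq> 0" "area2 z\<^sub>3 z\<^sub>1 z\<^sub>2 \<noteq> 0"
    using area2_nonzero_if_noncollinear[of z\<^sub>1 z\<^sub>2 z\<^sub>3] nondeg T
      area2_rotate[of z\<^sub>1 z\<^sub>2 z\<^sub>3] area2_rotate[of z\<^sub>2 z\<^sub>3 z\<^sub>1] by simp_all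
  have h': "h\<^sub>T = dist z\<^sub>1 z\<^sub>2" using h T labels by (simp add: max_def)
  have z: "z = barycenter (z\<^sub>1, z\<^sub>2, z\<^sub>3)" "z = barycenter (z\<^sub>2, z\<^sub>3, z\<^sub>1)"
    "z = barycenter (z\<^sub>3, z\<^sub>1, z\<^sub>2)"
    unfolding z_def T by (simp_all add: add_ac)
  have split: "split_aspect_ratio (clough_tocher z T)
    = Max {aspect_ratio (z, z\<^sub>2, z\<^sub>3), aspect_ratio (z\<^sub>1, z, z\<^sub>3), aspect_ratio (z\<^sub>1, z\<^sub>2, z)}"
    by (simp add: split_aspect_ratio_def T)
  have "aspect_ratio (z, z\<^sub>2, z\<^sub>3) \<le> 3 * aspect_ratio T"
    using aspect_ratio_subtriangle_le[OF nz(2)] aspect_ratio_rotate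
    unfolding z(2)[symmetric] T by metis
  moreover have "aspect_ratio (z\<^sub>1, z, z\<^sub>3) \<le> 3 * aspect_ratio T"
    using aspect_ratio_subtriangle_le[OF nz(3)] aspect_ratio_rotate
    unfolding z(3)[symmetric] T by metis
  moreover have "aspect_ratio (z\<^sub>1, z\<^sub>2, z) \<le> 3 * aspect_ratio T"
    using aspect_ratio_subtriangle_le[OF nz(1)] unfolding z(1)[symmetric] T .
  moreover have "3 / (1 + a\<^sub>T / h\<^sub>T) * aspect_ratio T \<le> aspect_ratio (z\<^sub>1, z\<^sub>2, z)"
    using aspect_ratio_subtriangle_ge[OF nz(1)] labels
    unfolding z(1)[symmetric] T a h' by simp
  ultimately show ?thesis
    unfolding z_def[symmetric] split by (simp add: le_max_iff_disj)
qed

end
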